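(* Let $f:\mathbb{R}^{d_x}\to\mathbb{R}$ be convex and $L_f$-smooth for some $L_f>0$, let $g:\mathbb{R}^{d_x}\to\mathbb{R}$ be $L_g$-smooth for some $L_g>0$ and $\mu_g$-strongly convex for some $\mu_g\ge0$, let $h:\mathbb{R}^{d_y}\to\mathbb{R}\cup\{+\infty\}$ be proper, closed and convex with convex conjugate $h^*$, and let $\mathsf{K}:\mathbb{R}^{d_x}\to\mathbb{R}^{d_y}$ be linear with operator norm $\|\mathsf{K}\|$ and $\lambda_{\min}(\mathsf{K}\mathsf{K}^* )>0$. Let $(x^\star,y^\star,z^\star)$ satisfy $$0=\nabla g(x^\star)+\mathsf{K}^*y^\star+\nabla f(z^\star),\qquad 0\in\partial h^*(y^\star)-\mathsf{K}x^\star,\qquad z^\star=x^\star.$$ Let $\eta_x,\eta_y,\eta_z>0$ satisfy $8\|\mathsf{K}\|^2\eta_x\eta_y\le1$ and $8L_f\eta_x\eta_z\le1$, and let $(x^k,y^k,z^k)_{k\ge0}$ be generated, from an arbitrary initial point, by any one of the four algorithms ACV-I, ACV-II, APDTR-I, APDTR-II with these stepsizes. Define $$\Psi_k=\frac1{2\eta_x}\|x^k-x^\star\|^2+\frac1{2\eta_y}\|y^k-y^\star\|^2+\frac1{\eta_z}D_f(z^k;z^\star)+s_1\langle y^k-y^\star,\mathsf{K}(x^k-x^\star)\rangle+s_2\langle\nabla f(z^k)-\nabla f(z^\star),x^k-x^\star\rangle,$$ where $(s_1,s_2)=(-1,-1)$ for ACV-I, $(+1,-1)$ for ACV-II, $(-1,+1)$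 for APDTR-I and $(+1,+1)$ for APDTR-II. Then for every $k\ge0$, $\Psi_k\le\theta^k\Psi_0$, where $$\theta=\max\left\{\frac2{2+\mu_g\eta_x},\ \frac{40}{40+\lambda_{\min}(\mathsf{K}\mathsf{K}^* )\eta_x\eta_y},\ \frac{20}{20+\frac{\lambda_{\min}(\mathsf{K}\mathsf{K}^* )}{L_g+L_f}\eta_y},\ \frac2{2+\eta_z}\right\}.$$
   Context: A proper closed function $\phi$ is $\mu$-strongly convex ($\mu\ge0$; $\mu=0$ means convex) if $\phi(x)\ge\phi(y)+\langle p,x-y\rangle+\frac{\mu}{2}\|x-y\|^2$ for all $x,y\in\mathrm{dom}(\phi)$ and all $p\in\partial\phi(y)$. A differentiable $\phi$ is $L$-smooth if $\nabla\phi$ is $L$-Lipschitz. $h^*(y)=\sup_u\{\langle y,u\rangle-h(u)\}$. $D_f(x;y)=f(x)-f(y)-\langle\nabla f(y),x-y\rangle$. $\mathrm{prox}_F(v)=\arg\min_w\{F(w)+\frac12\|w-v\|^2\}$. $\mathsf{K}^*$ is the adjoint of $\mathsf{K}$ and $\lambda_{\min}(\mathsf{K}\mathsf{K}^* )$ is the smallest eigenvalue of $\mathsf{K}\mathsf{K}^*$. The underlying problem is $\min_x f(x)+g(x)+h(\mathsf{K}x)$. Each algorithm starts from $x^0,z^0\in\mathbb{R}^{d_x}$, $y^0\in\mathbb{R}^{d_y}$ and, for $k=0,1,2,\dots$, performs in the order listed: ACV-I: $x^{k+1}=\mathrm{prox}_{\eta_xg}(x^k-\eta_x\mathsf{K}^*y^k-\eta_x\nabla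 f(z^k))$; $y^{k+1}=\mathrm{prox}_{\eta_yh^*}(y^k+\eta_y\mathsf{K}(2x^{k+1}-x^k))$; $z^{k+1}=\frac1{1+\eta_z}z^k+\frac{\eta_z}{1+\eta_z}(2x^{k+1}-x^k)$. ACV-II: $y^{k+1}=\mathrm{prox}_{\eta_yh^*}(y^k+\eta_y\mathsf{K}x^k)$; $x^{k+1}=\mathrm{prox}_{\eta_xg}(x^k-\eta_x\mathsf{K}^*(2y^{k+1}-y^k)-\eta_x\nabla f(z^k))$; $z^{k+1}=\frac1{1+\eta_z}z^k+\frac{\eta_z}{1+\eta_z}(2x^{k+1}-x^k)$. APDTR-I: $z^{k+1}=\frac1{1+\eta_z}z^k+\frac{\eta_z}{1+\eta_z}x^k$; $x^{k+1}=\mathrm{prox}_{\eta_xg}(x^k-\eta_x\mathsf{K}^*y^k-\eta_x(2\nabla f(z^{k+1})-\nabla f(z^k)))$; $y^{k+1}=\mathrm{prox}_{\eta_yh^*}(y^k+\eta_y\mathsf{K}(2x^{k+1}-x^k))$. APDTR-II: $y^{k+1}=\mathrm{prox}_{\eta_yh^*}(y^k+\eta_y\mathsf{K}x^k)$; $z^{k+1}=\frac1{1+\eta_z}z^k+\frac{\eta_z}{1+\eta_z}x^k$; $x^{k+1}=\mathrm{prox}_{\eta_xg}(x^k-\eta_x\mathsf{K}^*(2y^{k+1}-y^k)-\eta_x(2\nabla f(z^{k+1})-\nabla f(z^k)))$. *)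

theory Defs
  imports "HOL-Analysis.Analysis"
begin

definition effective_dom :: "('a \<Rightarrow> ereal) \<Rightarrow> 'a set" where
  "effective_dom \<phi> = {x. \<phi> x < \<infinity>}"

definition proper_fun :: "('a \<Rightarrow> ereal) \<Rightarrow> bool" where
  "proper_fun \<phi> \<longleftrightarrow> (\<forall>x. \<phi> x \<noteq> -\<infinity>) \<and> effective_dom \<phi> \<noteq> {}"

definition ereal_epigraph :: "('a \<Rightarrow> ereal) \<Rightarrow> ('a \<times> real) set" where
  "ereal_epigraph \<phi> = {(x, r). \<phi> x \<le> ereal r}"

definition closed_fun :: "('a::topological_space \<Rightarrow> ereal) \<Rightarrow> bool" where
  "closed_fun \<phi> \<longleftrightarrow> closed (ereal_epigraph \<phi>)"

definition convex_fun :: "('a::real_vector \<Rightarrow> ereal) \<Rightarrow> bool" where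
  "convex_fun \<phi> \<longleftrightarrow> convex (ereal_epigraph \<phi>)"

definition subdifferential :: "('a::real_inner \<Rightarrow> ereal) \<Rightarrow> 'a \<Rightarrow> 'a set" where
  "subdifferential \<phi> y =
     {p. y \<in> effective_dom \<phi> \<and> (\<forall>x. \<phi> x \<ge> \<phi> y + ereal (p \<bullet> (x - y)))}"

text \<open>
  The subgradient inequality alone says nothing at points without subgradients, and for
  \<open>\<mu> = 0\<close> it is just the definition of a subgradient. Convexity is therefore a separate
  conjunct, so that \<open>0\<close>-strongly convex means convex.
\<close>

definition strongly_convex :: "real \<Rightarrow> ('a::real_inner \<Rightarrow> ereal) \<Rightarrow> bool" where
  "strongly_convex \<mu> \<phi> \<longleftrightarrow> convex_fun \<phi> \<and>
     (\<forall>x \<in> effective_dom \<phi>. \<forall>y \<in> effective_dom \<phi>. \<forall>p \<in> subdifferential \<phi> y.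
        \<phi> x \<ge> \<phi> y + ereal (p \<bullet> (x - y)) + ereal (\<mu> / 2 * (norm (x - y))\<^sup>2))"

definition convex_conjugate :: "('a::real_inner \<Rightarrow> ereal) \<Rightarrow> 'a \<Rightarrow> ereal" where
  "convex_conjugate h y = (SUP u. ereal (y \<bullet> u) - h u)"

definition prox :: "('a::real_normed_vector \<Rightarrow> ereal) \<Rightarrow> 'a \<Rightarrow> 'a" where
  "prox F v = (ARG_MIN (\<lambda>w. F w + ereal (1 / 2 * (norm (w - v))\<^sup>2)) w. True)"

definition grad :: "('a::real_inner \<Rightarrow> real) \<Rightarrow> 'a \<Rightarrow> 'a" where
  "grad f x = (THE D. GDERIV f x :> D)"

definition smooth_fun :: "real \<Rightarrow> ('a::real_inner \<Rightarrow> real) \<Rightarrow> bool" where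
  "smooth_fun L f \<longleftrightarrow> (\<forall>x. f differentiable (at x)) \<and> L-lipschitz_on UNIV (grad f)"

definition bregman :: "('a::real_inner \<Rightarrow> real) \<Rightarrow> 'a \<Rightarrow> 'a \<Rightarrow> real" where
  "bregman f x y = f x - f y - grad f y \<bullet> (x - y)"

definition eigenvalue_of :: "('a::real_vector \<Rightarrow> 'a) \<Rightarrow> real \<Rightarrow> bool" where
  "eigenvalue_of T l \<longleftrightarrow> (\<exists>v. v \<noteq> 0 \<and> T v = l *\<^sub>R v)"

definition lambda_min :: "('a::real_vector \<Rightarrow> 'a) \<Rightarrow> real" where
  "lambda_min T = (LEAST l. eigenvalue_of T l)"

datatype algorithm = ACV_I | ACV_II | APDTR_I | APDTR_II

fun alg_step ::
  "algorithm \<Rightarrow> ('a::euclidean_space \<Rightarrow> real) \<Rightarrow> ('a \<Rightarrow> real) \<Rightarrow> ('b::euclidean_space \<Rightarrow> ereal)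
    \<Rightarrow> ('a \<Rightarrow> 'b) \<Rightarrow> real \<Rightarrow> real \<Rightarrow> real \<Rightarrow> 'a \<times> 'b \<times> 'a \<Rightarrow> 'a \<times> 'b \<times> 'a" where
  "alg_step ACV_I f g h K \<eta>x \<eta>y \<eta>z (x, y, z) =
    (let x' = prox (\<lambda>u. ereal (\<eta>x * g u)) (x - \<eta>x *\<^sub>R adjoint K y - \<eta>x *\<^sub>R grad f z);
         y' = prox (\<lambda>v. ereal \<eta>y * convex_conjugate h v) (y + \<eta>y *\<^sub>R K (2 *\<^sub>R x' - x));
         z' = (1 / (1 + \<eta>z)) *\<^sub>R z + (\<eta>z / (1 + \<eta>z)) *\<^sub>R (2 *\<^sub>R x' - x)
     in (x', y', z'))"
| "alg_step ACV_II f g h K \<eta>x \<eta>y \<eta>z (x, y, z) =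
    (let y' = prox (\<lambda>v. ereal \<eta>y * convex_conjugate h v) (y + \<eta>y *\<^sub>R K x);
         x' = prox (\<lambda>u. ereal (\<eta>x * g u))
                (x - \<eta>x *\<^sub>R adjoint K (2 *\<^sub>R y' - y) - \<eta>x *\<^sub>R grad f z);
         z' = (1 / (1 + \<eta>z)) *\<^sub>R z + (\<eta>z / (1 + \<eta>z)) *\<^sub>R (2 *\<^sub>R x' - x)
     in (x', y', z'))"
| "alg_step APDTR_I f g h K \<eta>x \<eta>y \<eta>z (x, y, z) =
    (let z' = (1 / (1 + \<eta>z)) *\<^sub>R z + (\<eta>z / (1 + \<eta>z)) *\<^sub>R x;
         x' = prox (\<lambda>u. ereal (\<eta>x * g u))
                (x - \<eta>x *\<^sub>R adjoint K y - \<eta>x *\<^sub>R (2 *\<^sub>R grad f z' - grad f z));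
         y' = prox (\<lambda>v. ereal \<eta>y * convex_conjugate h v) (y + \<eta>y *\<^sub>R K (2 *\<^sub>R x' - x))
     in (x', y', z'))"
| "alg_step APDTR_II f g h K \<eta>x \<eta>y \<eta>z (x, y, z) =
    (let y' = prox (\<lambda>v. ereal \<eta>y * convex_conjugate h v) (y + \<eta>y *\<^sub>R K x);
         z' = (1 / (1 + \<eta>z)) *\<^sub>R z + (\<eta>z / (1 + \<eta>z)) *\<^sub>R x;
         x' = prox (\<lambda>u. ereal (\<eta>x * g u))
                (x - \<eta>x *\<^sub>R adjoint K (2 *\<^sub>R y' - y) - \<eta>x *\<^sub>R (2 *\<^sub>R grad f z' - grad f z))
     in (x', y', z'))"

fun sign1 :: "algorithm \<Rightarrow> real" where
  "sign1 ACV_I = -1"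
| "sign1 ACV_II = 1"
| "sign1 APDTR_I = -1"
| "sign1 APDTR_II = 1"

fun sign2 :: "algorithm \<Rightarrow> real" where
  "sign2 ACV_I = -1"
| "sign2 ACV_II = -1"
| "sign2 APDTR_I = 1"
| "sign2 APDTR_II = 1"

definition lyapunov ::
  "algorithm \<Rightarrow> ('a::euclidean_space \<Rightarrow> real) \<Rightarrow> ('a \<Rightarrow> 'b::euclidean_space) \<Rightarrow> real \<Rightarrow> real \<Rightarrow> real
    \<Rightarrow> 'a \<times> 'b \<times> 'a \<Rightarrow> 'a \<times> 'b \<times> 'a \<Rightarrow> real" where
  "lyapunov alg f K \<eta>x \<eta>y \<eta>z = (\<lambda>(xs, ys, zs) (x, y, z).
     1 / (2 * \<eta>x) * (norm (x - xs))\<^sup>2 + 1 / (2 * \<eta>y) * (norm (y - ys))\<^sup>2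
     + 1 / \<eta>z * bregman f z zs
     + sign1 alg * ((y - ys) \<bullet> K (x - xs))
     + sign2 alg * ((grad f z - grad f zs) \<bullet> (x - xs)))"

end

theory Submission
  imports Defs
begin

text \<open>
  Each algorithm is a proximal point step in a metric skewed by the coupling terms, so pairing the
  optimality conditions of the step with the new iterate expresses \<open>\<Psi>\<^sub>k - \<Psi>\<^sub>k\<^sub>+\<^sub>1\<close> as squared
  increments, plus coupling terms of the increments, plus the monotonicity gaps of \<open>\<nabla>g\<close>,
  \<open>\<partial>h\<^sup>*\<close> and \<open>\<nabla>f\<close>. The stepsize conditions absorb the coupling terms. The gaps control
  \<open>x - x\<^sup>\<star>\<close> through \<open>\<mu>\<^sub>g\<close> and the Bregman distance of \<open>z\<close> directly. For \<open>y - y\<^sup>\<star>\<close>, the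
  \<open>x\<close>-update writes \<open>K\<^sup>*(y - y\<^sup>\<star>)\<close> as a combination of increments and gradient differences,
  which cocoercivity bounds by the gaps, and \<open>\<lambda>\<^sub>m\<^sub>i\<^sub>n\<close> converts this into a bound on \<open>y - y\<^sup>\<star>\<close>.
\<close>

section \<open>Gradients of smooth convex functions\<close>

text \<open>Since \<open>grad\<close> is a definite description, both existence and uniqueness are
  needed. The adjoint of the derivative applied to 1 is its Riesz representative, and uniqueness of
  the derivative does the rest.\<close>

lemma GDERIV_grad:
  fixes f :: "'a::euclidean_space \<Rightarrow> real"
  assumes "f differentiable (at x)"
  shows "GDERIV f x :> grad f x"
proof -
  obtain f' where f': "(f has_derivative f') (at x)"
    using assms by (auto simp: differentiable_def)
  have lin: "linear f'"
    using f' by (simp add: has_derivative_linear)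
  have "f' = (\<lambda>h. h \<bullet> adjoint f' 1)"
    using adjoint_works[OF lin] by auto
  then have D: "GDERIV f x :> adjoint f' 1"
    using f' by (simp add: gderiv_def)
  show ?thesis
    unfolding grad_def
  proof (rule theI[of "\<lambda>D. GDERIV f x :> D", OF D])
    fix E assume "GDERIV f x :> E"
    then have "(\<lambda>h. h \<bullet> E) = (\<lambda>h. h \<bullet> adjoint f' 1)"
      using D by (auto simp: gderiv_def intro: has_derivative_unique)
    then have "\<forall>h. h \<bullet> E = h \<bullet> adjoint f' 1"
      by (rule fun_cong[THEN allI])
    then show "E = adjoint f' 1"
      by (simp only: vector_eq_ldot)
  qed
qed

lemma DERIV_along_line:
  fixes f :: "'a::euclidean_space \<Rightarrow> real"
  assumes "\<And>x. f differentiable (at x)"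
  shows "((\<lambda>t. f (x + t *\<^sub>R d)) has_real_derivative grad f (x + t *\<^sub>R d) \<bullet> d) (at t)"
proof -
  have "((\<lambda>t. x + t *\<^sub>R d) has_derivative (\<lambda>s. s *\<^sub>R d)) (at t)"
    by (auto intro!: derivative_eq_intros)
  moreover have "(f has_derivative (\<lambda>h. h \<bullet> grad f (x + t *\<^sub>R d))) (at (x + t *\<^sub>R d))"
    using GDERIV_grad[OF assms] by (simp add: gderiv_def)
  ultimately have "((\<lambda>t. f (x + t *\<^sub>R d)) has_derivative
      (\<lambda>s. (s *\<^sub>R d) \<bullet> grad f (x + t *\<^sub>R d))) (at t)"
    by (rule has_derivative_compose)
  moreover have "(\<lambda>s. (s *\<^sub>R d) \<bullet> grad f (x + t *\<^sub>R d)) = (*) (grad f (x + t *\<^sub>R d) \<bullet> d)"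
    by (rule ext) (simp add: inner_commute)
  ultimately show ?thesis
    by (simp only: has_field_derivative_def)
qed

lemma convex_grad_ineq:
  fixes f :: "'a::euclidean_space \<Rightarrow> real"
  assumes diff: "\<And>x. f differentiable (at x)" and conv: "convex_on UNIV f"
  shows "f y \<ge> f x + grad f x \<bullet> (y - x)"
proof -
  have "convex_on UNIV (\<lambda>t. f (x + t *\<^sub>R (y - x)))"
  proof (rule convex_onI)
    fix t s s' :: real assume t: "0 < t" "t < 1"
    have "x + ((1 - t) *\<^sub>R s + t *\<^sub>R s') *\<^sub>R (y - x)
        = (1 - t) *\<^sub>R (x + s *\<^sub>R (y - x)) + t *\<^sub>R (x + s' *\<^sub>R (y - x))"
      by (simp add: algebra_simps)
    then show "f (x + ((1 - t) *\<^sub>R s + t *\<^sub>R s') *\<^sub>R (y - x))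
        \<le> (1 - t) * f (x + s *\<^sub>R (y - x)) + t * f (x + s' *\<^sub>R (y - x))"
      using convex_onD[OF conv, of t] t by simp
  qed simp
  from convex_on_imp_above_tangent[OF this, of 0 1 "grad f x \<bullet> (y - x)"]
  show ?thesis
    using DERIV_along_line[OF diff, of x "y - x" 0] by simp
qed

text \<open>Along the segment, \<open>\<phi>\<close> subtracts from f its tangent and the quadratic
  upper bound on the remainder. Cauchy-Schwarz and the Lipschitz bound make its derivative
  nonpositive on [0, 1].\<close>

lemma smooth_descent:
  fixes f :: "'a::euclidean_space \<Rightarrow> real"
  assumes sm: "smooth_fun L f"
  shows "f y \<le> f x + grad f x \<bullet> (y - x) + L / 2 * (norm (y - x))\<^sup>2"
proof -
  define d where "d = y - x"
  define \<phi> where "\<phi> t = f (x + t *\<^sub>R d) - t * (grad f x \<bullet> d) - L / 2 * t\<^sup>2 * (norm d)\<^sup>2" for t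
  have diff: "\<And>x. f differentiable (at x)"
    using sm by (simp add: smooth_fun_def)
  have lip: "norm (grad f u - grad f v) \<le> L * norm (u - v)" for u v
    using sm lipschitz_onD[of L UNIV "grad f" u v] by (simp add: smooth_fun_def dist_norm)
  have "\<phi> 1 \<le> \<phi> 0"
  proof (rule DERIV_nonpos_imp_nonincreasing[of 0 1 \<phi>])
    fix t :: real assume t: "0 \<le> t" "t \<le> 1"
    have der: "(\<phi> has_real_derivative
        (grad f (x + t *\<^sub>R d) - grad f x) \<bullet> d - L * t * (norm d)\<^sup>2) (at t)"
      unfolding \<phi>_def
      by (auto intro!: derivative_eq_intros DERIV_along_line[OF diff] simp: inner_diff_left)
    have "(grad f (x + t *\<^sub>R d) - grad f x) \<bullet> d \<le> norm (grad f (x + t *\<^sub>R d) - grad f x) * norm d"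
      by (rule norm_cauchy_schwarz)
    also have "\<dots> \<le> (L * norm (x + t *\<^sub>R d - x)) * norm d"
      by (intro mult_right_mono lip) auto
    also have "\<dots> = L * t * (norm d)\<^sup>2"
      using t by (simp add: power2_eq_square)
    finally show "\<exists>D. DERIV \<phi> t :> D \<and> D \<le> 0"
      using der by auto
  qed simp
  then show ?thesis
    by (simp add: \<phi>_def d_def)
qed

text \<open>The tilted function \<open>u \<mapsto> f u - \<nabla>f(x) \<bullet> u\<close> is minimal at \<open>x\<close>; evaluate it after a gradient
  step of length \<open>1/L\<close> from \<open>y\<close>.\<close>
lemma bregman_ge_grad_diff:
  fixes f :: "'a::euclidean_space \<Rightarrow> real"
  assumes sm: "smooth_fun L f" and conv: "convex_on UNIV f" and "L > 0"
  shows "bregman f y x \<ge> (norm (grad f y - grad f x))\<^sup>2 / (2 * L)"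
proof -
  define e where "e = grad f y - grad f x"
  define u where "u = y - (1 / L) *\<^sub>R e"
  have diff: "\<And>x. f differentiable (at x)"
    using sm by (simp add: smooth_fun_def)
  have 1: "f u \<ge> f x + grad f x \<bullet> (u - x)"
    by (rule convex_grad_ineq[OF diff conv])
  have 2: "f u \<le> f y + grad f y \<bullet> (u - y) + L / 2 * (norm (u - y))\<^sup>2"
    by (rule smooth_descent[OF sm])
  have 3: "grad f y \<bullet> (u - y) - grad f x \<bullet> (u - x) = - (norm e)\<^sup>2 / L - grad f x \<bullet> (y - x)"
    unfolding u_def e_def
    by (simp add: power2_norm_eq_inner inner_diff_left inner_diff_right inner_commute
        diff_divide_distrib add_divide_distrib)
  have 4: "L / 2 * (norm (u - y))\<^sup>2 = (norm e)\<^sup>2 / (2 * L)"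
    using \<open>L > 0\<close> by (simp add: u_def power_divide power2_eq_square)
  have "(norm e)\<^sup>2 / L = 2 * ((norm e)\<^sup>2 / (2 * L))"
    by simp
  then show ?thesis
    using 1 2 3 4 unfolding bregman_def e_def by linarith
qed

lemma bregman_symmetric_sum:
  "bregman f x y + bregman f y x = (grad f x - grad f y) \<bullet> (x - y)"
  by (simp add: bregman_def inner_diff_left inner_diff_right)

text \<open>Tilting g by a subgradient p makes y a global minimizer, so the derivative of the tilted
  function vanishes at y.\<close>

lemma subdifferential_ereal_eq_grad:
  fixes g :: "'a::euclidean_space \<Rightarrow> real"
  assumes diff: "g differentiable (at y)" and p: "p \<in> subdifferential (\<lambda>u. ereal (g u)) y"
  shows "p = grad g y"
proof -
  define G where "G u = g u - u \<bullet> p" for u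
  have "(G has_derivative (\<lambda>h. h \<bullet> grad g y - h \<bullet> p)) (at y)"
    using GDERIV_grad[OF diff] unfolding G_def gderiv_def
    by (auto intro!: derivative_eq_intros)
  moreover have "G y \<le> G u" for u
    using p by (auto simp: subdifferential_def G_def inner_commute inner_diff_right
        dest: spec[of _ u])
  ultimately have "(\<lambda>h. h \<bullet> grad g y - h \<bullet> p) = (\<lambda>h. 0)"
    using differential_zero_maxmin[of y UNIV G] by auto
  \<comment> \<open>The vanishing derivative is evaluated in the direction
    \<open>grad g y - p\<close>, which gives the squared norm of that vector.\<close>
  then have "(grad g y - p) \<bullet> grad g y - (grad g y - p) \<bullet> p = 0"
    by metis
  then show ?thesis
    by (metis eq_iff_diff_eq_0 inner_diff_right inner_eq_zero_iff)
qed

lemma convex_fun_ereal_imp_convex_on: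
  fixes g :: "'a::real_vector \<Rightarrow> real"
  assumes "convex_fun (\<lambda>u. ereal (g u))"
  shows "convex_on UNIV g"
proof (rule convex_onI)
  fix t :: real and x y assume t: "0 < t" "t < 1"
  have "(1 - t) *\<^sub>R (x, g x) + t *\<^sub>R (y, g y) \<in> ereal_epigraph (\<lambda>u. ereal (g u))"
    using assms t unfolding convex_fun_def
    by (intro convexD) (auto simp: ereal_epigraph_def)
  then show "g ((1 - t) *\<^sub>R x + t *\<^sub>R y) \<le> (1 - t) * g x + t * g y"
    by (simp add: ereal_epigraph_def)
qed simp

text \<open>Strong convexity is stated for subgradients only; convexity is what makes the gradient
  one of them.\<close>

lemma strongly_convex_grad_ineq:
  fixes g :: "'a::euclidean_space \<Rightarrow> real"
  assumes diff: "\<And>x. g differentiable (at x)" and sc: "strongly_convex \<mu> (\<lambda>u. ereal (g u))"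
  shows "g x \<ge> g y + grad g y \<bullet> (x - y) + \<mu> / 2 * (norm (x - y))\<^sup>2"
proof -
  have "convex_on UNIV g"
    using sc convex_fun_ereal_imp_convex_on by (auto simp: strongly_convex_def)
  then have "grad g y \<in> subdifferential (\<lambda>u. ereal (g u)) y"
    using convex_grad_ineq[OF diff] by (auto simp: subdifferential_def effective_dom_def)
  then show ?thesis
    using sc by (fastforce simp: strongly_convex_def effective_dom_def)
qed

section \<open>Proximal points\<close>

text \<open>Because \<open>prox\<close> is a choice operator, a minimizer has to be exhibited.
  Closedness is a property of the epigraph, so the continuous function \<open>\<psi>\<close> is
  minimized there instead of the extended-valued objective; the affine minorant supplies
  coercivity.\<close>

lemma prox_is_minimizer:
  fixes F :: "'a::euclidean_space \<Rightarrow> ereal"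
  assumes "\<eta> > 0" and proper: "proper_fun F" and clos: "closed_fun F"
    and minor: "\<And>w. F w \<ge> ereal (p \<bullet> w + b)"
  defines "E \<equiv> \<lambda>v w. ereal \<eta> * F w + ereal (1 / 2 * (norm (w - v))\<^sup>2)"
  shows "E v (prox (\<lambda>w. ereal \<eta> * F w) v) \<le> E v u"
proof -
  define \<psi> where "\<psi> = (\<lambda>(w, r). \<eta> * r + 1 / 2 * (norm (w - v))\<^sup>2)"
  have cont: "continuous_on UNIV \<psi>"
    unfolding \<psi>_def case_prod_beta by (intro continuous_intros)
  obtain w0 r0 where w0: "F w0 = ereal r0"
    using proper unfolding proper_fun_def effective_dom_def
    by (metis (mono_tags, lifting) empty_Collect_eq ereal_cases ereal_less_PInfty less_irrefl)
  define S where "S = ereal_epigraph F \<inter> {q. \<psi> q \<le> \<psi> (w0, r0)}"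
  have clS: "closed S"
    unfolding S_def using clos cont
    by (intro closed_Int closed_Collect_le) (auto simp: closed_fun_def)
  \<comment> \<open>By Young's inequality the affine minorant costs at most
    \<open>\<eta>\<^sup>2 * (norm p)\<^sup>2\<close> plus a quarter of the squared distance to v. A
    quarter of that distance then remains, and c bounds it on S.\<close>
  define c where "c = \<psi> (w0, r0) - \<eta> * (p \<bullet> v + b) + \<eta>\<^sup>2 * (norm p)\<^sup>2"
  have bnd: "(norm (w - v))\<^sup>2 \<le> 4 * c \<and> p \<bullet> w + b \<le> r \<and> r \<le> \<psi> (w0, r0) / \<eta>"
    if "(w, r) \<in> S" for w r
  proof -
    have r: "p \<bullet> w + b \<le> r"
      using that minor[of w] order_trans by (fastforce simp: S_def ereal_epigraph_def)
    have le: "\<eta> * r + 1 / 2 * (norm (w - v))\<^sup>2 \<le> \<psi> (w0, r0)"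
      using that by (simp add: S_def \<psi>_def)
    have "\<eta> * r \<ge> \<eta> * (p \<bullet> v + b) + (\<eta> *\<^sub>R p) \<bullet> (w - v)"
      using mult_left_mono[OF r, of \<eta>] \<open>\<eta> > 0\<close> by (simp add: algebra_simps inner_diff_right)
    moreover have "- (\<eta> * norm p * norm (w - v)) \<le> (\<eta> *\<^sub>R p) \<bullet> (w - v)"
      using Cauchy_Schwarz_ineq2[of "\<eta> *\<^sub>R p" "w - v"] \<open>\<eta> > 0\<close> by simp
    moreover have "\<eta> * norm p * norm (w - v) \<le> \<eta>\<^sup>2 * (norm p)\<^sup>2 + 1 / 4 * (norm (w - v))\<^sup>2"
      using zero_le_power2[of "\<eta> * norm p - norm (w - v) / 2"]
      by (simp add: power2_diff power_mult_distrib power_divide)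
    ultimately have "\<eta> * (p \<bullet> v + b) - (\<eta>\<^sup>2 * (norm p)\<^sup>2 + 1 / 4 * (norm (w - v))\<^sup>2) \<le> \<eta> * r"
      by linarith
    then have "(norm (w - v))\<^sup>2 \<le> 4 * c"
      using le unfolding c_def by argo
    moreover have "r \<le> \<psi> (w0, r0) / \<eta>"
    proof -
      have "\<eta> * r \<le> \<psi> (w0, r0)"
        using le zero_le_power2[of "norm (w - v)"] by argo
      then show ?thesis
        using \<open>\<eta> > 0\<close> by (simp add: field_simps)
    qed
    ultimately show ?thesis
      using r by blast
  qed
  have "bounded S"
  proof -
    have "S \<subseteq> cball v (sqrt (4 * c)) \<times>
        {- norm p * (norm v + sqrt (4 * c)) + b .. \<psi> (w0, r0) / \<eta>}"
    proof safe
      fix w r assume S: "(w, r) \<in> S"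
      have n: "norm (w - v) \<le> sqrt (4 * c)"
        using bnd[OF S] real_le_rsqrt by blast
      then show "w \<in> cball v (sqrt (4 * c))"
        by (simp add: dist_norm norm_minus_commute)
      have "norm w \<le> norm v + sqrt (4 * c)"
        using n norm_triangle_ineq2[of w v] by linarith
      then have "norm p * norm w \<le> norm p * (norm v + sqrt (4 * c))"
        by (intro mult_left_mono) auto
      moreover have "\<bar>p \<bullet> w\<bar> \<le> norm p * norm w"
        by (rule Cauchy_Schwarz_ineq2)
      ultimately show "r \<in> {- norm p * (norm v + sqrt (4 * c)) + b .. \<psi> (w0, r0) / \<eta>}"
        using bnd[OF S] by auto
    qed
    then show ?thesis
      by (intro bounded_subset[OF bounded_Times[OF bounded_cball bounded_closed_interval]])
  qed
  then have "compact S"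
    using clS by (simp add: compact_eq_bounded_closed)
  moreover have "(w0, r0) \<in> S"
    by (simp add: S_def ereal_epigraph_def w0)
  ultimately obtain w1 r1 where w1: "(w1, r1) \<in> S" and min: "\<And>q. q \<in> S \<Longrightarrow> \<psi> (w1, r1) \<le> \<psi> q"
    using continuous_attains_inf[of S \<psi>] continuous_on_subset[OF cont, of S] by force
  have minE: "E v w1 \<le> E v u" for u
  proof (cases "F u")
    case (real r)
    \<comment> \<open>Epigraph points outside S have a larger value than the reference point, so the
      minimum over S is the minimum over the whole epigraph.\<close>
    have "\<psi> (w1, r1) \<le> \<psi> (u, r)"
    proof (cases "(u, r) \<in> S")
      case False
      then have "\<psi> (w0, r0) < \<psi> (u, r)"
        using real by (auto simp: S_def ereal_epigraph_def)
      then show ?thesis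
        using w1 by (simp add: S_def)
    qed (rule min)
    moreover have "F w1 \<le> ereal r1"
      using w1 by (simp add: S_def ereal_epigraph_def)
    then have "E v w1 \<le> ereal (\<psi> (w1, r1))"
      using proper \<open>\<eta> > 0\<close> unfolding E_def \<psi>_def proper_fun_def
      by (cases "F w1") auto
    moreover have "E v u = ereal (\<psi> (u, r))"
      by (simp add: E_def \<psi>_def real)
    ultimately show ?thesis
      by (metis ereal_less_eq(3) order_trans)
  next
    case PInf
    then show ?thesis
      using \<open>\<eta> > 0\<close> by (simp add: E_def)
  next
    case MInf
    then show ?thesis
      using proper by (simp add: proper_fun_def)
  qed
  then have "is_arg_min (E v) (\<lambda>_. True) w1"
    by (simp add: is_arg_min_linorder)
  then have "is_arg_min (E v) (\<lambda>_. True) (prox (\<lambda>w. ereal \<eta> * F w) v)"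
    unfolding prox_def arg_min_def E_def by (rule someI)
  then show ?thesis
    by (simp add: is_arg_min_linorder)
qed

text \<open>Compare the minimizer \<open>w\<close> with \<open>w + t (u - w)\<close> and let \<open>t\<close> tend to \<open>0\<close>.\<close>
lemma prox_optimality:
  fixes F :: "'a::euclidean_space \<Rightarrow> ereal"
  assumes "\<eta> > 0" and proper: "proper_fun F" and clos: "closed_fun F" and conv: "convex_fun F"
    and minor: "\<And>w. F w \<ge> ereal (p \<bullet> w + b)"
    and w: "w = prox (\<lambda>w. ereal \<eta> * F w) v"
  shows "(1 / \<eta>) *\<^sub>R (v - w) \<in> subdifferential F w"
proof -
  have min: "ereal \<eta> * F w + ereal (1 / 2 * (norm (w - v))\<^sup>2)
      \<le> ereal \<eta> * F u + ereal (1 / 2 * (norm (u - v))\<^sup>2)" for u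
    unfolding w by (rule prox_is_minimizer[OF \<open>\<eta> > 0\<close> proper clos minor])
  obtain w0 r0 where w0: "F w0 = ereal r0"
    using proper unfolding proper_fun_def effective_dom_def
    by (metis (mono_tags, lifting) empty_Collect_eq ereal_cases ereal_less_PInfty less_irrefl)
  obtain a where a: "F w = ereal a"
    using min[of w0] w0 proper \<open>\<eta> > 0\<close> unfolding proper_fun_def by (cases "F w") auto
  have "F u \<ge> F w + ereal ((1 / \<eta>) *\<^sub>R (v - w) \<bullet> (u - w))" for u
  proof (cases "F u")
    case (real r)
    define d where "d = u - w"
    have key: "(v - w) \<bullet> d \<le> \<eta> * (r - a) + t / 2 * (norm d)\<^sup>2" if t: "0 < t" "t < 1" for t
    proof -
      have "(1 - t) *\<^sub>R (w, a) + t *\<^sub>R (u, r) \<in> ereal_epigraph F"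
        using conv t real a unfolding convex_fun_def
        by (intro convexD) (auto simp: ereal_epigraph_def)
      moreover have "(1 - t) *\<^sub>R w + t *\<^sub>R u = w + t *\<^sub>R d"
        by (simp add: d_def algebra_simps)
      ultimately have le: "F (w + t *\<^sub>R d) \<le> ereal ((1 - t) * a + t * r)"
        by (simp add: ereal_epigraph_def)
      then obtain s where s: "F (w + t *\<^sub>R d) = ereal s" "s \<le> (1 - t) * a + t * r"
        using proper unfolding proper_fun_def by (cases "F (w + t *\<^sub>R d)") auto
      have "\<eta> * a + 1 / 2 * (norm (w - v))\<^sup>2 \<le> \<eta> * s + 1 / 2 * (norm (w + t *\<^sub>R d - v))\<^sup>2"
        using min[of "w + t *\<^sub>R d"] s a by simp
      moreover define e where "e = w - v"
      have e: "w + t *\<^sub>R d - v = e + t *\<^sub>R d" "v - w = - e"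
        by (simp_all add: e_def)
      have "(norm (w + t *\<^sub>R d - v))\<^sup>2
          = (norm (w - v))\<^sup>2 - 2 * t * ((v - w) \<bullet> d) + t\<^sup>2 * (norm d)\<^sup>2"
        unfolding e power2_norm_eq_inner
        by (simp add: e_def[symmetric] inner_add_left inner_add_right inner_commute[of d e]
            power2_eq_square algebra_simps)
      moreover have "\<eta> * s \<le> \<eta> * ((1 - t) * a + t * r)"
        using s \<open>\<eta> > 0\<close> by simp
      ultimately have "t * ((v - w) \<bullet> d) \<le> t * (\<eta> * (r - a) + t / 2 * (norm d)\<^sup>2)"
        by (simp add: algebra_simps power2_eq_square)
      then show ?thesis
        using t by simp
    qed
    have "(v - w) \<bullet> d \<le> \<eta> * (r - a)"
    proof (rule tendsto_lowerbound)
      show "((\<lambda>t. \<eta> * (r - a) + t / 2 * (norm d)\<^sup>2) \<longlongrightarrow> \<eta> * (r - a)) (at_right 0)"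
        by (auto intro!: tendsto_eq_intros)
      show "\<forall>\<^sub>F t in at_right 0. (v - w) \<bullet> d \<le> \<eta> * (r - a) + t / 2 * (norm d)\<^sup>2"
        unfolding eventually_at_right_field using key zero_less_one by blast
    qed simp
    then have "((v - w) \<bullet> d) / \<eta> \<le> r - a"
      using \<open>\<eta> > 0\<close> by (simp add: field_simps)
    then show ?thesis
      using a real by (simp add: d_def)
  next
    case MInf
    then show ?thesis
      using proper by (simp add: proper_fun_def)
  qed simp
  then show ?thesis
    using a by (auto simp: subdifferential_def effective_dom_def)
qed

text \<open>The subdifferential of g contains at most the gradient, so the proximal inclusion
  becomes an equation. Continuity closes the epigraph and the tangent plane at 0 serves as affine
  minorant.\<close>

lemma convex_prox_grad:
  fixes g :: "'a::euclidean_space \<Rightarrow> real"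
  assumes "\<eta> > 0" and diff: "\<And>x. g differentiable (at x)" and conv: "convex_fun (\<lambda>u. ereal (g u))"
    and w: "w = prox (\<lambda>u. ereal (\<eta> * g u)) v"
  shows "grad g w = (1 / \<eta>) *\<^sub>R (v - w)"
proof -
  have cont: "continuous_on UNIV g"
    using diff differentiable_imp_continuous_within by (auto simp: continuous_on_eq_continuous_at)
  have "closed {q::'a \<times> real. g (fst q) \<le> snd q}"
    by (intro closed_Collect_le continuous_intros continuous_on_compose2[OF cont]) auto
  then have clos: "closed_fun (\<lambda>u. ereal (g u))"
    by (simp add: closed_fun_def ereal_epigraph_def case_prod_unfold)
  have "ereal (grad g 0 \<bullet> u + g 0) \<le> ereal (g u)" for u
    using convex_grad_ineq[OF diff convex_fun_ereal_imp_convex_on[OF conv], of 0 u] by simp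
  then have "(1 / \<eta>) *\<^sub>R (v - w) \<in> subdifferential (\<lambda>u. ereal (g u)) w"
    using prox_optimality[OF \<open>\<eta> > 0\<close> _ clos conv] w
    by (force simp: proper_fun_def effective_dom_def)
  then show ?thesis
    using subdifferential_ereal_eq_grad[OF diff] by metis
qed

section \<open>Convex conjugates\<close>

lemma epigraph_convex_conjugate:
  assumes "proper_fun h"
  shows "ereal_epigraph (convex_conjugate h)
    = (\<Inter>u \<in> effective_dom h. {q. fst q \<bullet> u - real_of_ereal (h u) \<le> snd q})"
proof -
  \<comment> \<open>Points where h is infinite contribute minus infinity to the supremum. The
    epigraph is thus an intersection of closed half-spaces, from which closedness and convexity of
    the conjugate follow.\<close>
  have "ereal (y \<bullet> u) - h u \<le> ereal r
      \<longleftrightarrow> (u \<in> effective_dom h \<longrightarrow> y \<bullet> u - real_of_ereal (h u) \<le> r)" for y u r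
    using assms unfolding proper_fun_def effective_dom_def by (cases "h u") auto
  then show ?thesis
    by (auto simp: ereal_epigraph_def convex_conjugate_def SUP_le_iff)
qed

lemma closed_fun_convex_conjugate:
  fixes h :: "'a::real_inner \<Rightarrow> ereal"
  assumes "proper_fun h"
  shows "closed_fun (convex_conjugate h)"
  unfolding closed_fun_def epigraph_convex_conjugate[OF assms]
  by (intro closed_INT ballI closed_Collect_le continuous_intros)

lemma convex_fun_convex_conjugate:
  fixes h :: "'a::real_inner \<Rightarrow> ereal"
  assumes "proper_fun h"
  shows "convex_fun (convex_conjugate h)"
  unfolding convex_fun_def epigraph_convex_conjugate[OF assms]
proof (intro convex_INT ballI convexI)
  fix u and q q' :: "'a \<times> real" and s t :: real
  assume q: "q \<in> {q. fst q \<bullet> u - real_of_ereal (h u) \<le> snd q}"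
    and q': "q' \<in> {q. fst q \<bullet> u - real_of_ereal (h u) \<le> snd q}"
    and st: "0 \<le> s" "0 \<le> t" "s + t = 1"
  have "s * (fst q \<bullet> u - real_of_ereal (h u)) + t * (fst q' \<bullet> u - real_of_ereal (h u))
      \<le> s * snd q + t * snd q'"
    using q q' st by (intro add_mono mult_left_mono) auto
  moreover have "s * real_of_ereal (h u) + t * real_of_ereal (h u) = real_of_ereal (h u)"
    using st by (metis distrib_right mult_1)
  ultimately show "s *\<^sub>R q + t *\<^sub>R q' \<in> {q. fst q \<bullet> u - real_of_ereal (h u) \<le> snd q}"
    by (simp add: inner_add_left algebra_simps)
qed

text \<open>This is Fenchel's inequality at one point where h is finite; it provides the coercivity
  needed for the proximal step on the conjugate.\<close>

lemma convex_conjugate_minorant: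
  assumes "proper_fun h"
  obtains p b where "\<And>y. convex_conjugate h y \<ge> ereal (p \<bullet> y + b)"
proof -
  obtain u r where u: "h u = ereal r"
    using assms unfolding proper_fun_def effective_dom_def
    by (metis (mono_tags, lifting) empty_Collect_eq ereal_cases ereal_less_PInfty less_irrefl)
  have "convex_conjugate h y \<ge> ereal (u \<bullet> y + - r)" for y
    unfolding convex_conjugate_def
    by (rule SUP_upper2[of u]) (auto simp: u inner_commute)
  then show thesis ..
qed

lemma subdifferential_monotone:
  assumes proper: "proper_fun F" and p: "p \<in> subdifferential F y" and q: "q \<in> subdifferential F z"
  shows "(p - q) \<bullet> (y - z) \<ge> 0"
proof -
  obtain a b where "F y = ereal a" "F z = ereal b"
    using p q proper unfolding subdifferential_def effective_dom_def proper_fun_def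
    by (metis (mono_tags, lifting) ereal_cases less_irrefl mem_Collect_eq)
  moreover have "F z \<ge> F y + ereal (p \<bullet> (z - y))" "F y \<ge> F z + ereal (q \<bullet> (y - z))"
    using p q by (auto simp: subdifferential_def)
  ultimately show ?thesis
    by (simp add: inner_diff_left inner_diff_right)
qed

section \<open>The coupling operator\<close>

lemma norm_adjoint_le:
  fixes K :: "'a::euclidean_space \<Rightarrow> 'b::euclidean_space"
  assumes "linear K"
  shows "norm (adjoint K v) \<le> onorm K * norm v"
proof -
  have "norm (adjoint K v) * norm (adjoint K v) = K (adjoint K v) \<bullet> v"
    using adjoint_works[OF assms, of "adjoint K v" v]
    by (simp add: power2_norm_eq_inner flip: power2_eq_square)
  also have "\<dots> \<le> norm (K (adjoint K v)) * norm v"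
    by (rule norm_cauchy_schwarz)
  also have "\<dots> \<le> (onorm K * norm (adjoint K v)) * norm v"
    using assms by (intro mult_right_mono onorm) (auto simp: linear_conv_bounded_linear)
  finally have "norm (adjoint K v) * norm (adjoint K v) \<le> norm (adjoint K v) * (onorm K * norm v)"
    by (simp add: ac_simps)
  moreover have "0 \<le> onorm K * norm v"
    using assms by (simp add: onorm_pos_le linear_conv_bounded_linear)
  ultimately show ?thesis
    by (cases "norm (adjoint K v) = 0") auto
qed

text \<open>The minimum of the Rayleigh quotient of \<open>K K\<^sup>*\<close> over the unit sphere is attained, and at an
  eigenvector; so the set of eigenvalues has a least element and the value of \<open>LEAST\<close> is meaningful.\<close>
lemma lambda_min_le:
  fixes K :: "'a::euclidean_space \<Rightarrow> 'b::euclidean_space"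
  assumes lin: "linear K"
  shows "lambda_min (K \<circ> adjoint K) * (norm v)\<^sup>2 \<le> (norm (adjoint K v))\<^sup>2"
proof -
  have linA: "linear (adjoint K)"
    by (rule adjoint_linear[OF lin])
  have cont: "continuous_on (sphere 0 1) (\<lambda>v. (norm (adjoint K v))\<^sup>2)"
    by (intro continuous_intros linear_continuous_on)
      (use linA linear_conv_bounded_linear in blast)
  have "sphere (0::'b) 1 \<noteq> {}"
    by simp
  then obtain v0 where v0: "norm v0 = 1"
    and min: "\<And>v. norm v = 1 \<Longrightarrow> (norm (adjoint K v0))\<^sup>2 \<le> (norm (adjoint K v))\<^sup>2"
    using continuous_attains_inf[OF compact_sphere _ cont] by auto
  define l where "l = (norm (adjoint K v0))\<^sup>2"
  have ray: "l * (norm v)\<^sup>2 \<le> (norm (adjoint K v))\<^sup>2" for v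
  proof (cases "v = 0")
    case False
    then have "l \<le> (norm (adjoint K ((1 / norm v) *\<^sub>R v)))\<^sup>2"
      unfolding l_def by (intro min) simp
    then show ?thesis
      using False by (simp add: linear_cmul[OF linA] power_divide field_simps)
  qed simp
  have A: "adjoint K u \<bullet> adjoint K w = u \<bullet> K (adjoint K w)" for u w
    using adjoint_works[OF lin, of "adjoint K w" u] by (metis inner_commute)
  define u where "u = K (adjoint K v0) - l *\<^sub>R v0"
  define b where "b = (norm (adjoint K u))\<^sup>2 - l * (norm u)\<^sup>2"
  \<comment> \<open>The form \<open>b\<close> measures the excess over l, which is nonnegative and
    vanishes at \<open>v0\<close>. Moving from \<open>v0\<close> along the residual u changes it by
    \<open>2 * t * (u \<bullet> u) + t\<^sup>2 * b\<close>, and this t turns that into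
    \<open>- t\<^sup>2 * (b + 2)\<close>, forcing t = 0 and u = 0. The denominator b + 1 avoids
    division by zero.\<close>
  define t where "t = - (u \<bullet> u) / (b + 1)"
  have "b \<ge> 0"
    using ray[of u] by (simp add: b_def)
  have "(norm (adjoint K (v0 + t *\<^sub>R u)))\<^sup>2 - l * (norm (v0 + t *\<^sub>R u))\<^sup>2
      = ((norm (adjoint K v0))\<^sup>2 - l * (norm v0)\<^sup>2)
        + 2 * t * (u \<bullet> K (adjoint K v0) - l * (u \<bullet> v0)) + t\<^sup>2 * b"
    unfolding b_def power2_norm_eq_inner
    by (simp add: linear_add[OF linA] linear_cmul[OF linA] inner_add_left inner_add_right
        inner_commute[of "adjoint K v0" "adjoint K u"] inner_commute[of v0 u] A[of u v0]
        algebra_simps power2_eq_square)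
  also have "\<dots> = 2 * t * (u \<bullet> u) + t\<^sup>2 * b"
    unfolding l_def[symmetric] using v0 by (simp add: u_def inner_diff_right)
  finally have "0 \<le> 2 * t * (u \<bullet> u) + t\<^sup>2 * b"
    using ray[of "v0 + t *\<^sub>R u"] by linarith
  moreover have u: "u \<bullet> u = - t * (b + 1)"
    using \<open>b \<ge> 0\<close> by (simp add: t_def)
  ultimately have "t\<^sup>2 * (b + 2) \<le> 0"
    by (simp add: algebra_simps power2_eq_square)
  then have "t = 0"
    using \<open>b \<ge> 0\<close> by (auto simp: mult_le_0_iff)
  then have "u = 0"
    using u by simp
  then have "eigenvalue_of (K \<circ> adjoint K) l"
    using v0 unfolding eigenvalue_of_def u_def by (intro exI[of _ v0]) auto
  moreover have "l \<le> l'" if ev: "eigenvalue_of (K \<circ> adjoint K) l'" for l'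
  proof -
    obtain w where w: "w \<noteq> 0" "K (adjoint K w) = l' *\<^sub>R w"
      using ev by (auto simp: eigenvalue_of_def)
    then have "(norm (adjoint K w))\<^sup>2 = l' * (norm w)\<^sup>2"
      using A[of w w] by (simp add: power2_norm_eq_inner)
    then show ?thesis
      using ray[of w] w by simp
  qed
  ultimately have "lambda_min (K \<circ> adjoint K) = l"
    unfolding lambda_min_def by (intro Least_equality)
  then show ?thesis
    using ray by simp
qed

text \<open>The stepsize condition bounds the square of the pairing by A * B / 8. The sharp factor
  in front of A + B would be 1 / (4 sqrt 2); 3/16 is a slightly larger rational.\<close>

lemma coupling_bound:
  fixes K :: "'a::euclidean_space \<Rightarrow> 'b::euclidean_space"
  assumes lin: "linear K" and pos: "\<sigma> > 0" "\<tau> > 0" and step: "8 * (onorm K)\<^sup>2 * \<sigma> * \<tau> \<le> 1"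
  shows "\<bar>u \<bullet> K v\<bar> \<le> 3 / 16 * ((norm v)\<^sup>2 / \<sigma> + (norm u)\<^sup>2 / \<tau>)"
proof -
  define A where "A = (norm v)\<^sup>2 / \<sigma>"
  define B where "B = (norm u)\<^sup>2 / \<tau>"
  have AB: "A \<ge> 0" "B \<ge> 0"
    using pos by (auto simp: A_def B_def)
  have "\<bar>u \<bullet> K v\<bar> \<le> norm u * norm (K v)"
    by (rule Cauchy_Schwarz_ineq2)
  also have "\<dots> \<le> norm u * (onorm K * norm v)"
    using lin by (intro mult_left_mono onorm) (auto simp: linear_conv_bounded_linear)
  finally have "(u \<bullet> K v)\<^sup>2 \<le> (norm u * (onorm K * norm v))\<^sup>2"
    using power_mono[of "\<bar>u \<bullet> K v\<bar>" _ 2] by simp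
  also have "\<dots> = ((onorm K)\<^sup>2 * \<sigma> * \<tau>) * (A * B)"
    using pos by (simp add: A_def B_def power_mult_distrib field_simps)
  also have "\<dots> \<le> (1 / 8) * (A * B)"
    using step AB by (intro mult_right_mono) auto
  also have "\<dots> \<le> (3 / 16 * (A + B))\<^sup>2"
    using zero_le_power2[of "A - B"] mult_nonneg_nonneg[OF AB]
    by (simp add: power2_eq_square algebra_simps)
  finally show ?thesis
    using abs_le_square_iff[of "u \<bullet> K v" "3 / 16 * (A + B)"] AB
    unfolding A_def B_def by simp
qed

section \<open>Young-type inequalities for norms\<close>

lemma young_inner:
  fixes u v :: "'a::real_inner"
  assumes "c > 0"
  shows "\<bar>u \<bullet> v\<bar> \<le> (norm v)\<^sup>2 / (4 * c) + c * (norm u)\<^sup>2"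
proof -
  have "norm u * norm v \<le> (norm v)\<^sup>2 / (4 * c) + c * (norm u)\<^sup>2"
    using assms zero_le_power2[of "norm v - 2 * c * norm u"]
    by (simp add: field_simps power2_eq_square)
  then show ?thesis
    using Cauchy_Schwarz_ineq2[of u v] by linarith
qed

text \<open>The two sides, after the triangle inequality, differ by a perfect square over L * M.
  With the two smoothness constants as weights it is the source of
  \<open>L\<^sub>g + L\<^sub>f\<close> in the rate.\<close>

lemma norm_add_sq_le_weighted:
  fixes p q :: "'a::real_normed_vector"
  assumes "L > 0" "M > 0"
  shows "(norm (p + q))\<^sup>2 \<le> (L + M) * ((norm p)\<^sup>2 / L + (norm q)\<^sup>2 / M)"
proof -
  have "(norm (p + q))\<^sup>2 \<le> (norm p + norm q)\<^sup>2"
    by (intro power_mono norm_triangle_ineq) simp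
  also have "\<dots> \<le> (L + M) * ((norm p)\<^sup>2 / L + (norm q)\<^sup>2 / M)"
  proof -
    have "(L + M) * ((norm p)\<^sup>2 / L + (norm q)\<^sup>2 / M) - (norm p + norm q)\<^sup>2
        = (M * norm p - L * norm q)\<^sup>2 / (L * M)"
      using assms by (simp add: field_simps power2_eq_square)
    also have "\<dots> \<ge> 0"
      using assms by simp
    finally show ?thesis
      by simp
  qed
  finally show ?thesis .
qed

lemma norm_add3_sq_le:
  fixes p q r :: "'a::real_normed_vector"
  shows "(norm (p + q + r))\<^sup>2 \<le> 3 * ((norm p)\<^sup>2 + (norm q)\<^sup>2 + (norm r)\<^sup>2)"
proof -
  have "(norm (p + q + r))\<^sup>2 \<le> 3 * ((norm (p + q))\<^sup>2 / 2 + (norm r)\<^sup>2)"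
    using norm_add_sq_le_weighted[of 2 1 "p + q" r] by simp
  moreover have "(norm (p + q))\<^sup>2 \<le> 2 * ((norm p)\<^sup>2 + (norm q)\<^sup>2)"
    using norm_add_sq_le_weighted[of 1 1 p q] by simp
  ultimately show ?thesis
    by argo
qed

section \<open>One step of the method\<close>

text \<open>All four algorithms are the same preconditioned proximal point step up to the two signs
  \<open>s\<^sub>1, s\<^sub>2\<close> of the extrapolation terms. Here all iterates are measured from the solution, \<open>w\<close>
  stands for the gradient of \<open>f\<close> at \<open>z\<close>, and \<open>q\<close>, \<open>r\<close> for (sub)gradients of \<open>g\<close> and \<open>h\<^sup>*\<close>.\<close>
lemma energy_identity:
  fixes x x' z z' w w' q :: "'a::euclidean_space" and y y' r :: "'b::euclidean_space"
    and K :: "'a \<Rightarrow> 'b" and s\<^sub>1 s\<^sub>2 :: real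
  assumes lin: "linear K"
    and q: "q = (1 / \<eta>x) *\<^sub>R (x - x') - adjoint K (y' + s\<^sub>1 *\<^sub>R (y' - y)) - (w' + s\<^sub>2 *\<^sub>R (w' - w))"
    and r: "r = (1 / \<eta>y) *\<^sub>R (y - y') + K (x' - s\<^sub>1 *\<^sub>R (x' - x))"
    and z': "z' = (1 / \<eta>z) *\<^sub>R (z - z') + (x' - s\<^sub>2 *\<^sub>R (x' - x))"
  shows "1 / (2 * \<eta>x) * (norm x)\<^sup>2 + 1 / (2 * \<eta>y) * (norm y)\<^sup>2
      + 1 / \<eta>z * (w' \<bullet> (z - z')) + s\<^sub>1 * (y \<bullet> K x) + s\<^sub>2 * (w \<bullet> x)
    = 1 / (2 * \<eta>x) * (norm x')\<^sup>2 + 1 / (2 * \<eta>y) * (norm y')\<^sup>2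
      + s\<^sub>1 * (y' \<bullet> K x') + s\<^sub>2 * (w' \<bullet> x')
      + 1 / (2 * \<eta>x) * (norm (x' - x))\<^sup>2 + 1 / (2 * \<eta>y) * (norm (y' - y))\<^sup>2
      + s\<^sub>1 * ((y' - y) \<bullet> K (x' - x)) + s\<^sub>2 * ((w' - w) \<bullet> (x' - x))
      + q \<bullet> x' + r \<bullet> y' + w' \<bullet> z'"
proof -
  have A: "adjoint K u \<bullet> v = u \<bullet> K v" for u v
    using adjoint_works[OF lin, of v u] by (metis inner_commute)
  have eq: "q \<bullet> x' = 1 / \<eta>x * (x \<bullet> x' - x' \<bullet> x') - (y' \<bullet> K x' + s\<^sub>1 * (y' \<bullet> K x' - y \<bullet> K x'))
      - (w' \<bullet> x' + s\<^sub>2 * (w' \<bullet> x' - w \<bullet> x'))"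
    unfolding q by (simp only: inner_diff_left inner_add_left inner_scaleR_left A)
  have er: "r \<bullet> y' = 1 / \<eta>y * (y \<bullet> y' - y' \<bullet> y')
      + (y' \<bullet> K x' - s\<^sub>1 * (y' \<bullet> K x' - y' \<bullet> K x))"
    unfolding r by (simp only: linear_diff[OF lin] linear_cmul[OF lin] inner_diff_left inner_add_left
        inner_scaleR_left inner_commute[of "K _" y'])
  \<comment> \<open>The relation for z' is implicit, with z' on both sides, so only one occurrence
    is replaced.\<close>
  have ez: "w' \<bullet> z' = 1 / \<eta>z * (w' \<bullet> (z - z')) + (w' \<bullet> x' - s\<^sub>2 * (w' \<bullet> x' - w' \<bullet> x))"
    by (subst (1) z') (simp only: inner_diff_right inner_add_right inner_scaleR_right)
  have sq: "(norm (b - a))\<^sup>2 = b \<bullet> b - 2 * (a \<bullet> b) + a \<bullet> a" for a b :: "'c::real_inner"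
    by (simp only: power2_norm_eq_inner inner_diff_left inner_diff_right inner_commute[of b a])
  have half: "1 / (2 * c) = 1 / c / 2" for c :: real
    by simp
  show ?thesis
    unfolding eq er ez sq half
    unfolding power2_norm_eq_inner linear_diff[OF lin] inner_diff_left[of y' y]
      inner_diff_left[of w' w] inner_diff_right[of _ "K x'"] inner_diff_right[of _ x']
    by (simp only: algebra_simps) (simp add: field_simps)
qed

text \<open>This turns the bare inner product of w' with z - z' in the energy identity into the
  decrease of the Bregman term, up to the distance from z to z'.\<close>

lemma bregman_three_point:
  "bregman f z u - bregman f z' u = bregman f z z' + (grad f z' - grad f u) \<bullet> (z - z')"
  by (simp add: bregman_def inner_diff_left inner_diff_right)

text \<open>With \<open>\<theta>\<close> = 1 / (1 + \<open>\<delta>\<close>), each entry of the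
  maximum becomes an upper bound on \<open>\<delta>\<close>. Each bound lets \<open>\<delta>\<close>
  times one part of the energy be absorbed by dissipation; the part in y needs two of them.\<close>

lemma one_step:
  fixes f g :: "'a::euclidean_space \<Rightarrow> real" and H :: "'b::euclidean_space \<Rightarrow> ereal"
    and K :: "'a \<Rightarrow> 'b" and s\<^sub>1 s\<^sub>2 \<nu> \<delta> :: real
  assumes f: "convex_on UNIV f" "smooth_fun L\<^sub>f f" "L\<^sub>f > 0"
    and g: "smooth_fun L\<^sub>g g" "L\<^sub>g > 0" "strongly_convex \<mu> (\<lambda>u. ereal (g u))"
    and H: "proper_fun H"
    and lin: "linear K" and "\<nu> > 0" and lam: "\<And>v. \<nu> * (norm v)\<^sup>2 \<le> (norm (adjoint K v))\<^sup>2"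
    and optx: "grad g xs + adjoint K ys + grad f xs = 0"
    and opty: "K xs \<in> subdifferential H ys"
    and pos: "\<eta>x > 0" "\<eta>y > 0" "\<eta>z > 0"
    and stepy: "8 * (onorm K)\<^sup>2 * \<eta>x * \<eta>y \<le> 1" and stepz: "8 * L\<^sub>f * \<eta>x * \<eta>z \<le> 1"
    and sgn: "\<bar>s\<^sub>1\<bar> = 1" "\<bar>s\<^sub>2\<bar> = 1"
    and gx: "grad g x' = (1 / \<eta>x) *\<^sub>R (x - x') - adjoint K (y' + s\<^sub>1 *\<^sub>R (y' - y))
      - (grad f z' + s\<^sub>2 *\<^sub>R (grad f z' - grad f z))"
    and hy: "(1 / \<eta>y) *\<^sub>R (y - y') + K (x' - s\<^sub>1 *\<^sub>R (x' - x)) \<in> subdifferential H y'"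
    and zz: "z' = (1 / \<eta>z) *\<^sub>R (z - z') + (x' - s\<^sub>2 *\<^sub>R (x' - x))"
    and \<delta>: "\<delta> \<ge> 0" "\<delta> \<le> \<mu> * \<eta>x / 2" "\<delta> \<le> \<nu> * \<eta>x * \<eta>y / 40"
      "\<delta> \<le> \<nu> / (L\<^sub>g + L\<^sub>f) * \<eta>y / 20" "\<delta> \<le> \<eta>z / 2"
  defines "V \<equiv> \<lambda>x y z. 1 / (2 * \<eta>x) * (norm (x - xs))\<^sup>2 + 1 / (2 * \<eta>y) * (norm (y - ys))\<^sup>2
     + 1 / \<eta>z * bregman f z xs + s\<^sub>1 * ((y - ys) \<bullet> K (x - xs))
     + s\<^sub>2 * ((grad f z - grad f xs) \<bullet> (x - xs))"
  shows "(1 + \<delta>) * V x' y' z' \<le> V x y z"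
proof -
  define w where "w = grad f z - grad f xs"
  define w' where "w' = grad f z' - grad f xs"
  define q where "q = grad g x' - grad g xs"
  define r where "r = (1 / \<eta>y) *\<^sub>R (y - y') + K (x' - s\<^sub>1 *\<^sub>R (x' - x)) - K xs"
  define dx where "dx = x' - x"
  define dy where "dy = y' - y"
  define dw where "dw = w' - w"
  define D where "D = bregman f z' xs"
  define E where "E = 1 / \<eta>z * bregman f z z'"
  define P where "P = 1 / \<eta>z * D"
  \<comment> \<open>The weights give all these squares the units of the energy, so the final balance
    has purely numerical coefficients.\<close>
  define X where "X = (norm (x' - xs))\<^sup>2 / \<eta>x"
  define Y where "Y = (norm (y' - ys))\<^sup>2 / \<eta>y"
  define a where "a = (norm dx)\<^sup>2 / \<eta>x"
  define b where "b = (norm dy)\<^sup>2 / \<eta>y"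
  define c where "c = \<eta>x * (norm dw)\<^sup>2"
  define W where "W = (norm w')\<^sup>2 / L\<^sub>f"
  define Q where "Q = (norm q)\<^sup>2 / L\<^sub>g"
  have diff_g: "\<And>x. g differentiable (at x)"
    using g by (simp add: smooth_fun_def)
  have conv_g: "convex_on UNIV g"
    using g convex_fun_ereal_imp_convex_on by (auto simp: strongly_convex_def)
  have linA: "linear (adjoint K)"
    by (rule adjoint_linear[OF lin])

  have qeq: "q = (1 / \<eta>x) *\<^sub>R ((x - xs) - (x' - xs))
      - adjoint K ((y' - ys) + s\<^sub>1 *\<^sub>R ((y' - ys) - (y - ys))) - (w' + s\<^sub>2 *\<^sub>R (w' - w))"
  proof -
    have "grad g xs = - adjoint K ys - grad f xs"
    proof -
      have "grad g xs = (grad g xs + adjoint K ys + grad f xs) - adjoint K ys - grad f xs"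
        by simp
      then show ?thesis
        unfolding optx by simp
    qed
    moreover have "adjoint K ((y' - ys) + s\<^sub>1 *\<^sub>R ((y' - ys) - (y - ys)))
        = adjoint K (y' + s\<^sub>1 *\<^sub>R (y' - y)) - adjoint K ys"
      unfolding linear_diff[OF linA, symmetric] by (simp add: algebra_simps)
    ultimately show ?thesis
      unfolding q_def gx w_def w'_def by simp
  qed
  have req: "r = (1 / \<eta>y) *\<^sub>R ((y - ys) - (y' - ys))
      + K ((x' - xs) - s\<^sub>1 *\<^sub>R ((x' - xs) - (x - xs)))"
    unfolding r_def by (simp add: linear_diff[OF lin] linear_cmul[OF lin])
  have zeq: "z' - xs = (1 / \<eta>z) *\<^sub>R ((z - xs) - (z' - xs))
      + ((x' - xs) - s\<^sub>2 *\<^sub>R ((x' - xs) - (x - xs)))"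
    by (subst zz) simp
  have "1 / \<eta>z * bregman f z xs = P + E + 1 / \<eta>z * (w' \<bullet> (z - z'))"
    using bregman_three_point[of f z xs z'] unfolding P_def D_def E_def w'_def
    by (metis distrib_left add.commute diff_add_cancel add.assoc)
  then have id: "V x y z = V x' y' z' + a / 2 + b / 2 + E + s\<^sub>1 * (dy \<bullet> K dx) + s\<^sub>2 * (dw \<bullet> dx)
      + q \<bullet> (x' - xs) + r \<bullet> (y' - ys) + w' \<bullet> (z' - xs)"
    using energy_identity[OF lin qeq req zeq]
    unfolding V_def a_def b_def dx_def dy_def dw_def D_def[symmetric] P_def[symmetric] w_def[symmetric] w'_def[symmetric]
    by simp

  have signed: "s\<^sub>1 * t \<le> \<bar>t\<bar>" "- \<bar>t\<bar> \<le> s\<^sub>1 * t" "s\<^sub>2 * t \<le> \<bar>t\<bar>" "- \<bar>t\<bar> \<le> s\<^sub>2 * t" for t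
  proof -
    have "\<bar>s\<^sub>1 * t\<bar> = \<bar>t\<bar>" "\<bar>s\<^sub>2 * t\<bar> = \<bar>t\<bar>"
      using sgn by (simp_all add: abs_mult)
    then show "s\<^sub>1 * t \<le> \<bar>t\<bar>" "- \<bar>t\<bar> \<le> s\<^sub>1 * t" "s\<^sub>2 * t \<le> \<bar>t\<bar>" "- \<bar>t\<bar> \<le> s\<^sub>2 * t"
      by linarith+
  qed
  have cross_y: "s\<^sub>1 * (dy \<bullet> K dx) \<ge> - (3 / 16 * (a + b))"
    using coupling_bound[OF lin pos(1,2) stepy, of dy dx] signed(2)[of "dy \<bullet> K dx"]
    unfolding a_def b_def by linarith
  have cross_y': "s\<^sub>1 * ((y' - ys) \<bullet> K (x' - xs)) \<le> 3 / 16 * (X + Y)"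
    using coupling_bound[OF lin pos(1,2) stepy, of "y' - ys" "x' - xs"]
      signed(1)[of "(y' - ys) \<bullet> K (x' - xs)"]
    unfolding X_def Y_def by linarith
  \<comment> \<open>Young's parameter \<open>2 * \<eta>x\<close> costs 2 * c, half of the 4 * c that
    E supplies, and only a / 8 of the a / 2 available.\<close>
  have cross_w: "s\<^sub>2 * (dw \<bullet> dx) \<ge> - (a / 8 + 2 * c)"
    using young_inner[of "2 * \<eta>x" dw dx] pos signed(4)[of "dw \<bullet> dx"]
    unfolding a_def c_def by (simp add: mult.commute)
  \<comment> \<open>This form of the second stepsize condition converts squared gradient differences
    weighted by \<open>\<eta>x\<close> into Bregman distances weighted by
    \<open>1 / \<eta>z\<close>.\<close>
  have scale: "4 * \<eta>x * n \<le> 1 / \<eta>z * (n / (2 * L\<^sub>f))" if "n \<ge> 0" for n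
    using mult_right_mono[OF stepz that] pos f by (simp add: field_simps)
  have E_ge: "E \<ge> 4 * c"
  proof -
    have "(norm (grad f z - grad f z'))\<^sup>2 = (norm dw)\<^sup>2"
      unfolding dw_def w_def w'_def by (simp add: norm_minus_commute)
    then have "1 / \<eta>z * ((norm dw)\<^sup>2 / (2 * L\<^sub>f)) \<le> E"
      unfolding E_def using bregman_ge_grad_diff[OF f(2,1,3), of z z'] pos
      by (intro mult_left_mono) auto
    then show ?thesis
      using scale[of "(norm dw)\<^sup>2"] by (simp add: c_def)
  qed
  have D_ge: "D \<ge> W / 2"
    using bregman_ge_grad_diff[OF f(2,1,3), of z' xs] by (simp add: D_def W_def w'_def)
  \<comment> \<open>Of the two Bregman distances in the symmetric sum, D is kept to absorb the
    z-part of the energy, and the reverse one is converted to W / 2.\<close>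
  have w'z': "w' \<bullet> (z' - xs) \<ge> D + W / 2"
    using bregman_symmetric_sum[of f z' xs] bregman_ge_grad_diff[OF f(2,1,3), of xs z']
    by (simp add: D_def W_def w'_def norm_minus_commute)
  have cross_w': "s\<^sub>2 * (w' \<bullet> (x' - xs)) \<le> X / 4 + P / 4"
  proof -
    have "4 * (\<eta>x * (norm w')\<^sup>2) \<le> 1 / \<eta>z * (W / 2)"
      using scale[of "(norm w')\<^sup>2"] by (simp add: W_def)
    also have "\<dots> \<le> P"
      unfolding P_def using D_ge pos by (intro mult_left_mono) auto
    finally have "\<eta>x * (norm w')\<^sup>2 \<le> P / 4"
      by linarith
    then show ?thesis
      using signed(3)[of "w' \<bullet> (x' - xs)"] young_inner[of \<eta>x w' "x' - xs"] pos by (simp add: X_def mult.commute)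
  qed
  have qx_Q: "q \<bullet> (x' - xs) \<ge> Q"
    using bregman_symmetric_sum[of g x' xs] bregman_ge_grad_diff[OF g(1) conv_g g(2), of xs x']
      bregman_ge_grad_diff[OF g(1) conv_g g(2), of x' xs]
    by (simp add: q_def Q_def norm_minus_commute)
  have \<delta>X: "\<delta> * X \<le> q \<bullet> (x' - xs) / 2"
  proof -
    have "\<mu> * (norm (x' - xs))\<^sup>2 \<le> q \<bullet> (x' - xs)"
      using strongly_convex_grad_ineq[OF diff_g g(3), of xs x']
        strongly_convex_grad_ineq[OF diff_g g(3), of x' xs]
      by (simp add: q_def norm_minus_commute inner_diff_left inner_diff_right)
    moreover have "\<delta> * X \<le> (\<mu> * \<eta>x / 2) * X"
      using \<delta> pos by (intro mult_right_mono) (auto simp: X_def)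
    ultimately show ?thesis
      using pos by (simp add: X_def)
  qed
  have \<delta>D: "\<delta> * P \<le> D / 2"
  proof -
    have "D \<ge> 0"
      using D_ge f by (auto simp: W_def intro: order_trans[rotated])
    then have "\<delta> * P \<le> (\<eta>z / 2) * P"
      unfolding P_def using \<delta> pos by (intro mult_right_mono) auto
    then show ?thesis
      using pos by (simp add: P_def)
  qed
  have ry: "r \<bullet> (y' - ys) \<ge> 0"
    unfolding r_def by (rule subdifferential_monotone[OF H hy opty])
  have \<delta>Y: "\<delta> * Y \<le> 3 / 20 * (b / 8 + a + c) + (W + Q) / 10"
  proof -
    \<comment> \<open>The x-update is solved for \<open>adjoint K (y' - ys)\<close>. A collects the
      increments and B the gradient gaps; they lead to the second and third entries of the rate
      respectively.\<close>
    define A where "A = adjoint K (- (s\<^sub>1 *\<^sub>R dy)) + - ((1 / \<eta>x) *\<^sub>R dx) + - (s\<^sub>2 *\<^sub>R dw)"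
    define B where "B = - (w' + q)"
    have "adjoint K (y' - ys) = A + B"
      unfolding A_def B_def dx_def dy_def dw_def
      by (subst qeq) (simp add: linear_diff[OF linA] linear_add[OF linA] linear_cmul[OF linA]
          linear_neg[OF linA] algebra_simps)
    then have "\<nu> * (norm (y' - ys))\<^sup>2 \<le> 2 * (norm A)\<^sup>2 + 2 * (norm B)\<^sup>2"
      using lam[of "y' - ys"] norm_add_sq_le_weighted[of 1 1 A B] by simp
    then have lamN: "\<nu> * (\<eta>y * Y) \<le> 2 * (norm A)\<^sup>2 + 2 * (norm B)\<^sup>2"
      using pos by (simp add: Y_def)
    have normA: "\<eta>x * (norm A)\<^sup>2 \<le> 3 * (b / 8 + a + c)"
    proof -
      have "(norm (adjoint K (- (s\<^sub>1 *\<^sub>R dy))))\<^sup>2 \<le> (onorm K * norm dy)\<^sup>2"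
        using norm_adjoint_le[OF lin, of "- (s\<^sub>1 *\<^sub>R dy)"] sgn by (intro power_mono) auto
      then have "\<eta>x * (norm (adjoint K (- (s\<^sub>1 *\<^sub>R dy))))\<^sup>2 \<le> \<eta>x * (onorm K * norm dy)\<^sup>2"
        using pos by simp
      also have "\<dots> = ((onorm K)\<^sup>2 * \<eta>x * \<eta>y) * b"
        using pos by (simp add: b_def power_mult_distrib)
      also have "\<dots> \<le> (1 / 8) * b"
        using stepy pos by (intro mult_right_mono) (auto simp: b_def)
      finally have 1: "\<eta>x * (norm (adjoint K (- (s\<^sub>1 *\<^sub>R dy))))\<^sup>2 \<le> b / 8"
        by simp
      have 2: "\<eta>x * (norm (- ((1 / \<eta>x) *\<^sub>R dx)))\<^sup>2 = a"
        using pos by (simp add: a_def power_divide power2_eq_square)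
      have 3: "\<eta>x * (norm (- (s\<^sub>2 *\<^sub>R dw)))\<^sup>2 = c"
        using sgn by (simp add: c_def)
      have "\<eta>x * (norm A)\<^sup>2 \<le> \<eta>x * (3 * ((norm (adjoint K (- (s\<^sub>1 *\<^sub>R dy))))\<^sup>2
          + (norm (- ((1 / \<eta>x) *\<^sub>R dx)))\<^sup>2 + (norm (- (s\<^sub>2 *\<^sub>R dw)))\<^sup>2))"
        unfolding A_def using pos by (intro mult_left_mono norm_add3_sq_le) simp
      also have "\<dots> \<le> 3 * (b / 8 + a + c)"
        using 1 unfolding distrib_left mult.left_commute[of \<eta>x 3] 2 3 by simp
      finally show ?thesis .
    qed
    have normB: "(norm B)\<^sup>2 / (L\<^sub>g + L\<^sub>f) \<le> W + Q"
      using norm_add_sq_le_weighted[of L\<^sub>f L\<^sub>g w' q] f g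
      unfolding B_def W_def Q_def norm_minus_cancel by (simp add: pos_divide_le_eq ac_simps)
    \<comment> \<open>Dividing \<open>\<delta>\<close> by the factor multiplying Y in
      \<open>lamN\<close> leaves one bound tailored to A and one tailored to B.\<close>
    define \<kappa> where "\<kappa> = \<delta> / (\<nu> * \<eta>y)"
    have \<kappa>: "\<kappa> \<ge> 0" "\<kappa> \<le> \<eta>x / 40" "\<kappa> \<le> 1 / (L\<^sub>g + L\<^sub>f) / 20"
      using \<delta> pos f g \<open>\<nu> > 0\<close> by (simp_all add: \<kappa>_def divide_simps mult_ac)
    have "\<delta> * Y = \<kappa> * (\<nu> * (\<eta>y * Y))"
      using pos \<open>\<nu> > 0\<close> by (simp add: \<kappa>_def)
    also have "\<dots> \<le> \<kappa> * (2 * (norm A)\<^sup>2 + 2 * (norm B)\<^sup>2)"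
      by (rule mult_left_mono[OF lamN \<kappa>(1)])
    also have "\<dots> = 2 * (\<kappa> * (norm A)\<^sup>2) + 2 * (\<kappa> * (norm B)\<^sup>2)"
      by (simp add: distrib_left)
    also have "\<dots> \<le> 2 * (\<eta>x / 40 * (norm A)\<^sup>2) + 2 * (1 / (L\<^sub>g + L\<^sub>f) / 20 * (norm B)\<^sup>2)"
      by (intro add_mono mult_left_mono mult_right_mono \<kappa>) auto
    also have "\<dots> = (\<eta>x * (norm A)\<^sup>2) / 20 + ((norm B)\<^sup>2 / (L\<^sub>g + L\<^sub>f)) / 10"
    proof -
      have "2 * (1 / M / 20 * n) = n / M / 10" "2 * (M / 40 * n) = M * n / 20" for M n :: real
        by simp_all
      then show ?thesis
        by (simp only:)
    qed
    also have "\<dots> \<le> 3 / 20 * (b / 8 + a + c) + (W + Q) / 10"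
    proof -
      have "u / 20 + v / 10 \<le> 3 / 20 * s + t / 10" if "u \<le> 3 * s" "v \<le> t" for u v s t :: real
        using that by linarith
      then show ?thesis
        using normA normB by blast
    qed
    finally show ?thesis .
  qed
  have nonneg: "a \<ge> 0" "b \<ge> 0" "c \<ge> 0" "W \<ge> 0" "Q \<ge> 0" "X \<ge> 0" "Y \<ge> 0"
    using pos f g by (simp_all add: a_def b_def c_def W_def Q_def X_def Y_def)
  have "V x' y' z' = X / 2 + Y / 2 + P + s\<^sub>1 * ((y' - ys) \<bullet> K (x' - xs)) + s\<^sub>2 * (w' \<bullet> (x' - xs))"
    unfolding V_def X_def Y_def P_def D_def w'_def by simp
  \<comment> \<open>The coefficients are 15/16 = 1/2 + 3/16 + 1/4, 11/16 = 1/2 + 3/16 and 5/4 = 1 +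
    1/4.\<close>
  also have "\<dots> \<le> 15 / 16 * X + 11 / 16 * Y + 5 / 4 * P"
    using cross_y'[unfolded distrib_left] cross_w' by linarith
  finally have "\<delta> * V x' y' z' \<le> \<delta> * (15 / 16 * X + 11 / 16 * Y + 5 / 4 * P)"
    using \<delta> by (intro mult_left_mono) auto
  also have "\<dots> = 15 / 16 * (\<delta> * X) + 11 / 16 * (\<delta> * Y) + 5 / 4 * (\<delta> * P)"
    by (simp add: algebra_simps)
  also have "\<dots> \<le> 15 / 32 * (q \<bullet> (x' - xs))
      + 33 / 320 * a + 33 / 2560 * b + 33 / 320 * c + 11 / 160 * W + 11 / 160 * Q + 5 / 8 * D"
    using \<delta>X \<delta>Y[unfolded distrib_left add_divide_distrib] \<delta>D by linarith
  \<comment> \<open>The right side is what the identity guarantees after the cross terms: 3/16 = 1/2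
    - 3/16 - 1/8 for a, 5/16 = 1/2 - 3/16 for b, and 4 - 2 for c. The Q term fits because Q is at
    most the gap of the gradient of g, of which only 15/32 is spent.\<close>
  also have "\<dots> \<le> 3 / 16 * a + 5 / 16 * b + 2 * c + q \<bullet> (x' - xs) + D + W / 2"
    using qx_Q nonneg D_ge by linarith
  also have "\<dots> \<le> V x y z - V x' y' z'"
    using id cross_y[unfolded distrib_left] cross_w E_ge w'z' ry by linarith
  finally show ?thesis
    by (simp add: algebra_simps)
qed

section \<open>Reduction of the four algorithms to the common step\<close>

lemma averaging_step:
  fixes z z' u :: "'a::real_vector"
  assumes "\<eta> > 0" and z': "z' = (1 / (1 + \<eta>)) *\<^sub>R z + (\<eta> / (1 + \<eta>)) *\<^sub>R u"
  shows "z' = (1 / \<eta>) *\<^sub>R (z - z') + u"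
proof -
  have "(1 + \<eta>) *\<^sub>R z' = z + \<eta> *\<^sub>R u"
    using \<open>\<eta> > 0\<close> by (simp add: z' scaleR_add_right)
  then have "z + \<eta> *\<^sub>R u - (1 + \<eta>) *\<^sub>R z' = 0"
    by (metis right_minus_eq)
  moreover have "z + \<eta> *\<^sub>R u - (1 + \<eta>) *\<^sub>R z' = (z - z') - \<eta> *\<^sub>R (z' - u)"
    by (simp add: scaleR_add_left scaleR_diff_right)
  ultimately have "z - z' = \<eta> *\<^sub>R (z' - u)"
    by (metis right_minus_eq)
  then have "(1 / \<eta>) *\<^sub>R (z - z') = z' - u"
    using \<open>\<eta> > 0\<close> by simp
  then show ?thesis
    by (metis diff_add_cancel)
qed

text \<open>A sign +1 puts the extrapolated dual point or gradient into the x-update and the old x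
  into the y- or z-update; a sign -1 exchanges the roles, with the extrapolation on x. The two signs
  vary independently, which yields the four methods.\<close>

lemma alg_step_optimality:
  fixes f g :: "'a::euclidean_space \<Rightarrow> real" and h :: "'b::euclidean_space \<Rightarrow> ereal"
    and K :: "'a \<Rightarrow> 'b"
  assumes g: "\<And>x. g differentiable (at x)" "convex_fun (\<lambda>u. ereal (g u))"
    and h: "proper_fun h" "proper_fun (convex_conjugate h)"
    and pos: "\<eta>x > 0" "\<eta>y > 0" "\<eta>z > 0"
    and step: "(x', y', z') = alg_step alg f g h K \<eta>x \<eta>y \<eta>z (x, y, z)"
  shows "grad g x' = (1 / \<eta>x) *\<^sub>R (x - x') - adjoint K (y' + sign1 alg *\<^sub>R (y' - y))
      - (grad f z' + sign2 alg *\<^sub>R (grad f z' - grad f z))" (is ?X)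
    and "(1 / \<eta>y) *\<^sub>R (y - y') + K (x' - sign1 alg *\<^sub>R (x' - x))
      \<in> subdifferential (convex_conjugate h) y'" (is ?Y)
    and "z' = (1 / \<eta>z) *\<^sub>R (z - z') + (x' - sign2 alg *\<^sub>R (x' - x))" (is ?Z)
proof -
  obtain p b where minor: "\<And>y. convex_conjugate h y \<ge> ereal (p \<bullet> y + b)"
    using convex_conjugate_minorant[OF h(1)] by blast
  have X: "grad g x' = (1 / \<eta>x) *\<^sub>R (x - x') - u"
    if "x' = prox (\<lambda>u. ereal (\<eta>x * g u)) (x - \<eta>x *\<^sub>R u)" for u
    using convex_prox_grad[OF pos(1) g that] pos by (simp add: scaleR_diff_right)
  have Y: "(1 / \<eta>y) *\<^sub>R (y - y') + u \<in> subdifferential (convex_conjugate h) y'"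
    if "y' = prox (\<lambda>v. ereal \<eta>y * convex_conjugate h v) (y + \<eta>y *\<^sub>R u)" for u
    using prox_optimality[OF pos(2) h(2) closed_fun_convex_conjugate[OF h(1)]
        convex_fun_convex_conjugate[OF h(1)] minor that] pos
    by (simp add: algebra_simps)
  have two: "a + (a - b) = 2 *\<^sub>R a - b" "a - (b - a) = 2 *\<^sub>R a - b" for a b :: "'c::real_vector"
    by (simp_all add: scaleR_2)
  have fold: "x - \<eta>x *\<^sub>R a - \<eta>x *\<^sub>R b = x - \<eta>x *\<^sub>R (a + b)" for a b
    by (simp add: scaleR_add_right)
  have "?X \<and> ?Y \<and> ?Z"
  proof (cases alg)
    case ACV_I
    then have s: "x' = prox (\<lambda>u. ereal (\<eta>x * g u)) (x - \<eta>x *\<^sub>R (adjoint K y + grad f z))"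
      "y' = prox (\<lambda>v. ereal \<eta>y * convex_conjugate h v) (y + \<eta>y *\<^sub>R K (2 *\<^sub>R x' - x))"
      "z' = (1 / (1 + \<eta>z)) *\<^sub>R z + (\<eta>z / (1 + \<eta>z)) *\<^sub>R (2 *\<^sub>R x' - x)"
      using step unfolding ACV_I alg_step.simps Let_def prod.inject fold by simp_all
    show ?thesis
      using X[OF s(1)] Y[OF s(2)] averaging_step[OF pos(3) s(3)] ACV_I
      by (simp add: two diff_diff_eq)
  next
    case ACV_II
    then have s: "y' = prox (\<lambda>v. ereal \<eta>y * convex_conjugate h v) (y + \<eta>y *\<^sub>R K x)"
      "x' = prox (\<lambda>u. ereal (\<eta>x * g u)) (x - \<eta>x *\<^sub>R (adjoint K (2 *\<^sub>R y' - y) + grad f z))"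
      "z' = (1 / (1 + \<eta>z)) *\<^sub>R z + (\<eta>z / (1 + \<eta>z)) *\<^sub>R (2 *\<^sub>R x' - x)"
      using step unfolding ACV_II alg_step.simps Let_def prod.inject fold by simp_all
    show ?thesis
      using X[OF s(2)] Y[OF s(1)] averaging_step[OF pos(3) s(3)] ACV_II
      by (simp add: two diff_diff_eq)
  next
    case APDTR_I
    then have s: "z' = (1 / (1 + \<eta>z)) *\<^sub>R z + (\<eta>z / (1 + \<eta>z)) *\<^sub>R x"
      "x' = prox (\<lambda>u. ereal (\<eta>x * g u))
        (x - \<eta>x *\<^sub>R (adjoint K y + (2 *\<^sub>R grad f z' - grad f z)))"
      "y' = prox (\<lambda>v. ereal \<eta>y * convex_conjugate h v) (y + \<eta>y *\<^sub>R K (2 *\<^sub>R x' - x))"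
      using step unfolding APDTR_I alg_step.simps Let_def prod.inject fold by simp_all
    show ?thesis
      using X[OF s(2)] Y[OF s(3)] averaging_step[OF pos(3) s(1)] APDTR_I
      by (simp add: two diff_diff_eq)
  next
    case APDTR_II
    then have s: "y' = prox (\<lambda>v. ereal \<eta>y * convex_conjugate h v) (y + \<eta>y *\<^sub>R K x)"
      "z' = (1 / (1 + \<eta>z)) *\<^sub>R z + (\<eta>z / (1 + \<eta>z)) *\<^sub>R x"
      "x' = prox (\<lambda>u. ereal (\<eta>x * g u))
        (x - \<eta>x *\<^sub>R (adjoint K (2 *\<^sub>R y' - y) + (2 *\<^sub>R grad f z' - grad f z)))"
      using step unfolding APDTR_II alg_step.simps Let_def prod.inject fold by simp_all
    show ?thesis
      using X[OF s(3)] Y[OF s(1)] averaging_step[OF pos(3) s(2)] APDTR_II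
      by (simp add: two diff_diff_eq)
  qed
  then show ?X ?Y ?Z
    by blast+
qed

section \<open>Geometric decay of the energy\<close>

theorem theorem3:
  fixes f g :: "real^'n \<Rightarrow> real"
    and h :: "real^'m \<Rightarrow> ereal"
    and K :: "real^'n \<Rightarrow> real^'m"
    and L\<^sub>f L\<^sub>g \<mu>\<^sub>g \<eta>x \<eta>y \<eta>z \<theta> :: real
    and xs zs :: "real^'n" and ys :: "real^'m"
    and x z :: "nat \<Rightarrow> real^'n" and y :: "nat \<Rightarrow> real^'m"
    and \<Psi> :: "nat \<Rightarrow> real"
    and alg :: algorithm
  assumes "L\<^sub>f > 0" and "convex_on UNIV f" and "smooth_fun L\<^sub>f f"
    and "L\<^sub>g > 0" and "smooth_fun L\<^sub>g g"
    and "\<mu>\<^sub>g \<ge> 0" and "strongly_convex \<mu>\<^sub>g (\<lambda>u. ereal (g u))"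
    and "proper_fun h" and "closed_fun h" and "convex_fun h"
    and "linear K" and "lambda_min (K \<circ> adjoint K) > 0"
    and "0 = grad g xs + adjoint K ys + grad f zs"
    and "0 \<in> (\<lambda>p. p - K xs) ` subdifferential (convex_conjugate h) ys"
    and "zs = xs"
    and "\<eta>x > 0" and "\<eta>y > 0" and "\<eta>z > 0"
    and "8 * (onorm K)\<^sup>2 * \<eta>x * \<eta>y \<le> 1"
    and "8 * L\<^sub>f * \<eta>x * \<eta>z \<le> 1"
    and "\<And>k. (x (Suc k), y (Suc k), z (Suc k)) =
           alg_step alg f g h K \<eta>x \<eta>y \<eta>z (x k, y k, z k)"
  defines "\<Psi> \<equiv> \<lambda>k. lyapunov alg f K \<eta>x \<eta>y \<eta>z (xs, ys, zs) (x k, y k, z k)"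
    and "\<theta> \<equiv> Max {2 / (2 + \<mu>\<^sub>g * \<eta>x),
                   40 / (40 + lambda_min (K \<circ> adjoint K) * \<eta>x * \<eta>y),
                   20 / (20 + lambda_min (K \<circ> adjoint K) / (L\<^sub>g + L\<^sub>f) * \<eta>y),
                   2 / (2 + \<eta>z)}"
  shows "\<forall>k. \<Psi> k \<le> \<theta> ^ k * \<Psi> 0"
proof -
  define \<nu> where "\<nu> = lambda_min (K \<circ> adjoint K)"
  have [simp]: "\<nu> > 0"
    using assms by (simp add: \<nu>_def)
  define \<delta> where "\<delta> = 1 / \<theta> - 1"
  define S where "S = {2 / (2 + \<mu>\<^sub>g * \<eta>x), 40 / (40 + \<nu> * \<eta>x * \<eta>y),
    20 / (20 + \<nu> / (L\<^sub>g + L\<^sub>f) * \<eta>y), 2 / (2 + \<eta>z)}"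
  have \<theta>: "\<theta> = Max S" and finS: "finite S" "S \<noteq> {}"
    by (simp_all add: \<theta>_def S_def \<nu>_def)
  \<comment> \<open>Every entry of the maximum has the form c / (c + d), whose reciprocal is 1 + d /
    c; taking reciprocals reverses the comparison with \<open>\<theta>\<close>.\<close>
  have rate: "\<delta> \<le> d / c" if "c / (c + d) \<in> S" "c > 0" "d \<ge> 0" for c d
  proof -
    have "0 < c / (c + d)" "c / (c + d) \<le> \<theta>"
      using that finS by (auto simp: \<theta>)
    then have "1 / \<theta> \<le> 1 / (c / (c + d))"
      by (intro divide_left_mono mult_pos_pos) linarith+
    also have "\<dots> = 1 + d / c"
      using that by (simp add: field_simps)
    finally show ?thesis
      by (simp add: \<delta>_def)
  qed
  have "\<theta> \<in> S"
    unfolding \<theta> using finS by (rule Max_in)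
  have nonneg: "\<mu>\<^sub>g * \<eta>x \<ge> 0" "\<nu> * \<eta>x * \<eta>y \<ge> 0" "\<nu> / (L\<^sub>g + L\<^sub>f) * \<eta>y \<ge> 0" "\<eta>z \<ge> 0"
    using assms(1,4,6,16-18) less_imp_le[OF \<open>\<nu> > 0\<close>] by simp_all
  have "0 < c / (c + d) \<and> c / (c + d) \<le> 1" if "c > 0" "d \<ge> 0" for c d :: real
    using that by simp
  then have "\<forall>e\<in>S. 0 < e \<and> e \<le> 1"
    using nonneg unfolding S_def by (metis insertE emptyE zero_less_numeral)
  then have \<theta>01: "0 < \<theta>" "\<theta> \<le> 1"
    using \<open>\<theta> \<in> S\<close> by blast+
  have \<delta>: "\<delta> \<ge> 0" "\<delta> \<le> \<mu>\<^sub>g * \<eta>x / 2" "\<delta> \<le> \<nu> * \<eta>x * \<eta>y / 40"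
    "\<delta> \<le> \<nu> / (L\<^sub>g + L\<^sub>f) * \<eta>y / 20" "\<delta> \<le> \<eta>z / 2"
  proof -
    show "\<delta> \<ge> 0"
      using \<theta>01 by (simp add: \<delta>_def)
    show "\<delta> \<le> \<mu>\<^sub>g * \<eta>x / 2" "\<delta> \<le> \<nu> * \<eta>x * \<eta>y / 40"
      "\<delta> \<le> \<nu> / (L\<^sub>g + L\<^sub>f) * \<eta>y / 20" "\<delta> \<le> \<eta>z / 2"
      by (rule rate[OF _ _ nonneg(1)] rate[OF _ _ nonneg(2)] rate[OF _ _ nonneg(3)]
          rate[OF _ _ nonneg(4)]; simp add: S_def)+
  qed
  have opty: "K xs \<in> subdifferential (convex_conjugate h) ys"
    using assms(14) by auto
  obtain p b where minor: "\<And>y. convex_conjugate h y \<ge> ereal (p \<bullet> y + b)"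
    using convex_conjugate_minorant[OF assms(8)] by blast
  \<comment> \<open>The domain is nonempty because a subgradient exists at \<open>ys\<close>, and
    the affine minorant excludes minus infinity.\<close>
  have proper: "proper_fun (convex_conjugate h)"
    using opty minor unfolding proper_fun_def subdifferential_def
    by (metis (no_types, lifting) MInfty_neq_ereal(1) empty_iff ereal_infty_less_eq(2) mem_Collect_eq)
  have diff_g: "\<And>x. g differentiable (at x)" and conv_g: "convex_fun (\<lambda>u. ereal (g u))"
    using assms(5,7) by (simp_all add: smooth_fun_def strongly_convex_def)
  have sgn: "\<bar>sign1 alg\<bar> = 1" "\<bar>sign2 alg\<bar> = 1"
    by (cases alg; simp)+
  have optx: "grad g xs + adjoint K ys + grad f xs = 0"
    using assms(13,15) by simp
  have contract: "\<Psi> (Suc k) \<le> \<theta> * \<Psi> k" for k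
  proof -
    note opt = alg_step_optimality[OF diff_g conv_g assms(8) proper assms(16-18,21)]
    have "(1 + \<delta>) * \<Psi> (Suc k) \<le> \<Psi> k"
      using one_step[OF assms(2,3,1,5,4,7) proper assms(11) \<open>\<nu> > 0\<close>
          lambda_min_le[OF assms(11), folded \<nu>_def] optx opty assms(16-20) sgn opt \<delta>]
      by (simp add: \<Psi>_def lyapunov_def \<open>zs = xs\<close>)
    \<comment> \<open>By the choice of \<open>\<delta>\<close>, the product of
      \<open>\<theta>\<close> and 1 + \<open>\<delta>\<close> is 1.\<close>
    then have "\<theta> * ((1 + \<delta>) * \<Psi> (Suc k)) \<le> \<theta> * \<Psi> k"
      using \<theta>01 by simp
    then show ?thesis
      using \<theta>01 by (simp add: \<delta>_def)
  qed
  show ?thesis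
  proof
    fix k show "\<Psi> k \<le> \<theta> ^ k * \<Psi> 0"
    proof (induction k)
      case (Suc k)
      then have "\<theta> * \<Psi> k \<le> \<theta> * (\<theta> ^ k * \<Psi> 0)"
        using \<theta>01 by simp
      then show ?case
        using contract[of k] by simp
    qed simp
  qed
qed

end
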